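(* Let $\mathcal{H}$ be a complex separable Hilbert space, $W$ a bounded selfadjoint operator on $\mathcal{H}$, and $\mathcal{S}$ a (not necessarily closed) subspace of $\mathcal{H}$. Then: 1. $\operatorname{dom}P_{W,\mathcal{S}}=\mathcal{S}+(W\mathcal{S})^\perp$ and $\operatorname{mul}P_{W,\mathcal{S}}=\mathcal{S}\cap(W\mathcal{S})^\perp$. If $W$ is positive semi-definite, then $\operatorname{mul}P_{W,\mathcal{S}}=\mathcal{S}\cap\ker W$. 2. $P_{W,\mathcal{S}}^*=P_{\overline{W\mathcal{S}},\,\mathcal{S}^\perp}$ and $\overline{P_{W,\mathcal{S}}}=P_{W,\overline{\mathcal{S}}}$. Consequently, $P_{W,\mathcal{S}}$ is closed if and only if $\mathcal{S}$ is closed. 3. $P_{W,\mathcal{S}}$ is $W$-symmetric, i.e. $WP_{W,\mathcal{S}}\subseteq(WP_{W,\mathcal{S}})^*$.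
   Context: A linear relation in $\mathcal{H}$ is a linear subspace $T$ of $\mathcal{H}\times\mathcal{H}$; operators are identified with their graphs. $\operatorname{dom}T$ is the domain, $\operatorname{mul}T=\{y:(0,y)\in T\}$, $RT=\{(x,y): (x,z)\in T,\ (z,y)\in R\text{ for some }z\}$, $\overline{T}$ is the closure of $T$ in $\mathcal{H}\times\mathcal{H}$, and $T^*=\{(x,y):\langle g,x\rangle=\langle f,y\rangle\text{ for all }(f,g)\in T\}$. For subspaces $\mathcal{M},\mathcal{N}$ (not necessarily closed), $P_{\mathcal{M},\mathcal{N}}:=\{(m+n,m):m\in\mathcal{M},n\in\mathcal{N}\}$ is the multivalued projection with range $\mathcal{M}$ and kernel $\mathcal{N}$. The $W$-orthogonal companion of $\mathcal{S}$ is $\mathcal{S}^{\perp_W}=\{x:\langle Wx,s\rangle=0\ \forall s\in\mathcal{S}\}=(W\mathcal{S})^\perp$, and $P_{W,\mathcal{S}}:=P_{\mathcal{S},\mathcal{S}^{\perp_W}}$. *)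

theory Defs
  imports "HOL-Analysis.Analysis"
begin

text \<open>
  The library has real, but no complex, inner product spaces. A complex inner product space is
  rendered as a \<^class>\<open>real_inner\<close> space with a compatible complex structure: the real inner
  product is the real part of the complex one. Positive definiteness of \<open>cinner\<close> and
  \<open>norm x = sqrt (Re (cinner x x))\<close> are thus inherited from \<^class>\<open>real_inner\<close>.
  The complex inner product is linear in its first argument.
\<close>

class complex_inner = real_inner +
  fixes scaleC :: "complex \<Rightarrow> 'a \<Rightarrow> 'a"  (infixr \<open>*\<^sub>C\<close> 75)
    and cinner :: "'a \<Rightarrow> 'a \<Rightarrow> complex"
  assumes scaleC_add_right: "a *\<^sub>C (x + y) = a *\<^sub>C x + a *\<^sub>C y"
    and scaleC_add_left: "(a + b) *\<^sub>C x = a *\<^sub>C x + b *\<^sub>C x"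
    and scaleC_scaleC: "a *\<^sub>C b *\<^sub>C x = (a * b) *\<^sub>C x"
    and scaleC_one: "1 *\<^sub>C x = x"
    and scaleC_of_real: "complex_of_real r *\<^sub>C x = scaleR r x"
    and cinner_commute: "cinner x y = cnj (cinner y x)"
    and cinner_add_left: "cinner (x + y) z = cinner x z + cinner y z"
    and cinner_scaleC_left: "cinner (a *\<^sub>C x) y = a * cinner x y"
    and Re_cinner: "Re (cinner x y) = inner x y"

class chilbert_space = complex_inner + complete_space

instantiation complex :: chilbert_space
begin

definition scaleC_complex :: "complex \<Rightarrow> complex \<Rightarrow> complex"
  where "scaleC_complex a x = a * x"

definition cinner_complex :: "complex \<Rightarrow> complex \<Rightarrow> complex"
  where "cinner_complex x y = x * cnj y"

instance
  by standard
    (auto simp: scaleC_complex_def cinner_complex_def inner_complex_def algebra_simps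
      scaleR_conv_of_real)

end

global_interpretation complex_vector: vector_space "scaleC :: complex \<Rightarrow> 'a \<Rightarrow> 'a::complex_inner"
  defines csubspace = complex_vector.subspace
  by unfold_locales (simp_all add: scaleC_add_right scaleC_add_left scaleC_scaleC scaleC_one)

definition bounded_clinear :: "('a::complex_inner \<Rightarrow> 'b::complex_inner) \<Rightarrow> bool"
  where "bounded_clinear f \<longleftrightarrow>
    Vector_Spaces.linear scaleC scaleC f \<and> (\<exists>K. \<forall>x. norm (f x) \<le> norm x * K)"

definition cortho_comp :: "'a::complex_inner set \<Rightarrow> 'a set"
  where "cortho_comp M = {x. \<forall>m\<in>M. cinner x m = 0}"

text \<open>
  A linear relation is a set of pairs. The domain is \<^const>\<open>Domain\<close>, and the product \<open>R T\<close>
  (first \<open>T\<close>, then \<open>R\<close>) is \<open>T O R\<close>.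
\<close>

definition graph_of :: "('a \<Rightarrow> 'b) \<Rightarrow> ('a \<times> 'b) set"
  where "graph_of f = {(x, f x) | x. True}"

definition mul :: "('a::zero \<times> 'b) set \<Rightarrow> 'b set"
  where "mul T = {y. (0, y) \<in> T}"

definition rel_adjoint :: "('a \<times> 'a) set \<Rightarrow> ('a::complex_inner \<times> 'a) set"
  where "rel_adjoint T = {(x, y). \<forall>(f, g)\<in>T. cinner g x = cinner f y}"

definition bounded_selfadjoint :: "('a::complex_inner \<Rightarrow> 'a) \<Rightarrow> bool"
  where "bounded_selfadjoint W \<longleftrightarrow>
    bounded_clinear W \<and> rel_adjoint (graph_of W) = graph_of W"

definition positive_semidefinite :: "('a::complex_inner \<Rightarrow> 'a) \<Rightarrow> bool"
  where "positive_semidefinite W \<longleftrightarrow> (\<forall>x. cinner (W x) x \<in> \<real>\<^sub>\<ge>\<^sub>0)"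

definition mproj :: "'a::plus set \<Rightarrow> 'a set \<Rightarrow> ('a \<times> 'a) set"
  where "mproj M N = {(m + n, m) | m n. m \<in> M \<and> n \<in> N}"

definition W_companion :: "('a::complex_inner \<Rightarrow> 'a) \<Rightarrow> 'a set \<Rightarrow> 'a set"
  where "W_companion W S = {x. \<forall>s\<in>S. cinner (W x) s = 0}"

definition W_proj :: "('a::complex_inner \<Rightarrow> 'a) \<Rightarrow> 'a set \<Rightarrow> ('a \<times> 'a) set"
  where "W_proj W S = mproj S (W_companion W S)"

definition W_symmetric :: "('a::complex_inner \<Rightarrow> 'a) \<Rightarrow> ('a \<times> 'a) set \<Rightarrow> bool"
  where "W_symmetric W T \<longleftrightarrow> T O graph_of W \<subseteq> rel_adjoint (T O graph_of W)"

end

theory Submission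
  imports Defs
begin

text \<open>
  The pair \<open>(m + n, m)\<close> is the image of \<open>(m, n)\<close> under a linear homeomorphism of \<open>H \<times> H\<close>, so the
  closure of a multivalued projection is taken range- and kernel-wise; the kernel \<open>(W S)\<^sup>\<bottom>\<close> is
  closed already and does not change when \<open>S\<close> is replaced by its closure. The adjoint is
  \<open>{(x, y). x - y \<in> S\<^sup>\<bottom> \<and> y \<in> (W S)\<^sup>\<bottom>\<^sup>\<bottom>}\<close>, and \<open>(W S)\<^sup>\<bottom>\<^sup>\<bottom>\<close> is the closure of \<open>W S\<close> by the
  projection theorem. For positive semidefinite \<open>W\<close>, Cauchy-Schwarz for the form \<open>\<langle>W x, y\<rangle>\<close> shows that
  \<open>\<langle>W x, x\<rangle> = 0\<close> forces \<open>W x = 0\<close>.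
\<close>

section \<open>Nearest points and orthogonal projection in a real Hilbert space\<close>

lemma minimizing_sequence_Cauchy:
  fixes x :: "'a::real_inner"
  assumes "convex S" and p: "\<And>n. p n \<in> S"
    and lim: "\<And>n. (dist x (p n))\<^sup>2 < (infdist x S)\<^sup>2 + 1 / real (Suc n)"
  shows "Cauchy p"
proof (rule metric_CauchyI)
  fix e :: real
  assume "e > 0"
  \<comment> \<open>The parallelogram law below bounds the squared distance by 2/(m+1) + 2/(n+1),
    which is at most 4/(N+1); hence the quarter of \<open>e\<^sup>2\<close>.\<close>
  then obtain N where N: "1 / real (Suc N) < e\<^sup>2 / 4"
    by (meson nat_approx_posE zero_less_divide_iff zero_less_numeral zero_less_power)
  have "dist (p m) (p n) < e" if "m \<ge> N" "n \<ge> N" for m n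
  proof -
    \<comment> \<open>The midpoint lies in \<open>S\<close>, so it is no closer to \<open>x\<close>
      than \<open>infdist x S\<close>. In the parallelogram law for \<open>x - p m\<close> and
      \<open>x - p n\<close> the \<open>infdist\<close> terms then cancel and only the errors
      remain.\<close>
    have "(1/2) *\<^sub>R p m + (1/2) *\<^sub>R p n \<in> S"
      using \<open>convex S\<close> p by (intro convexD) auto
    then have "(infdist x S)\<^sup>2 \<le> (dist x ((1/2) *\<^sub>R p m + (1/2) *\<^sub>R p n))\<^sup>2"
      by (intro power_mono infdist_le infdist_nonneg)
    moreover have "(dist (p m) (p n))\<^sup>2
      = 2 * (dist x (p m))\<^sup>2 + 2 * (dist x (p n))\<^sup>2
        - 4 * (dist x ((1/2) *\<^sub>R p m + (1/2) *\<^sub>R p n))\<^sup>2"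
      unfolding dist_norm power2_norm_eq_inner
      by (simp add: inner_simps inner_commute field_simps)
    moreover have "1 / real (Suc m) \<le> 1 / real (Suc N)" "1 / real (Suc n) \<le> 1 / real (Suc N)"
      using that by (auto intro!: divide_left_mono)
    ultimately have "(dist (p m) (p n))\<^sup>2 < e\<^sup>2"
      using lim[of m] lim[of n] N by linarith
    then show ?thesis
      using \<open>e > 0\<close> by (simp add: power2_less_imp_less)
  qed
  then show "\<exists>M. \<forall>m\<ge>M. \<forall>n\<ge>M. dist (p m) (p n) < e"
    by blast
qed

text \<open>Completeness replaces compactness: a minimizing sequence is Cauchy, and its limit stays
  in the closed set and attains the infimum.\<close>

lemma closed_convex_closest_point_exists:
  fixes x :: "'a::{real_inner, complete_space}"
  assumes "convex S" "closed S" "S \<noteq> {}"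
  shows "\<exists>p\<in>S. \<forall>z\<in>S. dist x p \<le> dist x z"
proof -
  have "\<exists>p\<in>S. (dist x p)\<^sup>2 < (infdist x S)\<^sup>2 + 1 / real (Suc n)" for n
  proof -
    have "infdist x S < sqrt ((infdist x S)\<^sup>2 + 1 / real (Suc n))"
      by (rule real_less_rsqrt) simp
    then obtain p where "p \<in> S" "dist x p < sqrt ((infdist x S)\<^sup>2 + 1 / real (Suc n))"
      using \<open>S \<noteq> {}\<close> by (auto simp: infdist_def dest!: cInf_lessD[rotated])
    then show ?thesis
      by (metis abs_of_nonneg real_sqrt_abs real_sqrt_less_iff zero_le_dist)
  qed
  then obtain p where p: "\<And>n. p n \<in> S"
    and lim: "\<And>n. (dist x (p n))\<^sup>2 < (infdist x S)\<^sup>2 + 1 / real (Suc n)"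
    by metis
  have "Cauchy p"
    by (rule minimizing_sequence_Cauchy[OF \<open>convex S\<close> p lim])
  then obtain q where q: "p \<longlonglongrightarrow> q"
    using Cauchy_convergent_iff convergent_def by blast
  have "q \<in> S"
    using \<open>closed S\<close> p q by (rule closed_sequentially)
  have "(\<lambda>n. (dist x (p n))\<^sup>2) \<longlonglongrightarrow> (dist x q)\<^sup>2"
    by (intro tendsto_power tendsto_dist tendsto_const q)
  moreover have "(\<lambda>n. (infdist x S)\<^sup>2 + 1 / real (Suc n)) \<longlonglongrightarrow> (infdist x S)\<^sup>2 + 0"
    by (intro tendsto_add tendsto_const LIMSEQ_inverse_real_of_nat[unfolded inverse_eq_divide])
  ultimately have "(dist x q)\<^sup>2 \<le> (infdist x S)\<^sup>2 + 0"
    using lim by (intro LIMSEQ_le[of _ "(dist x q)\<^sup>2"]) (auto intro!: less_imp_le)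
  then have "dist x q \<le> infdist x S"
    by (simp add: power2_le_iff_abs_le infdist_nonneg)
  then have "dist x q \<le> dist x z" if "z \<in> S" for z
    using infdist_le[OF that, of x] by linarith
  with \<open>q \<in> S\<close> show ?thesis
    by blast
qed

lemma subspace_orthogonal_projection_exists:
  fixes x :: "'a::{real_inner, complete_space}"
  assumes "subspace M"
  shows "\<exists>p\<in>closure M. \<forall>m\<in>M. inner (x - p) m = 0"
proof -
  have conv: "convex (closure M)" and ne: "closure M \<noteq> {}"
    using assms by (auto simp: subspace_imp_convex convex_closure dest: subspace_0)
  obtain p where p: "p \<in> closure M" "\<forall>z\<in>closure M. dist x p \<le> dist x z"
    using closed_convex_closest_point_exists[OF conv closed_closure ne, of x] by blast
  have le: "inner (x - p) m \<le> 0" if "m \<in> M" for m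
  proof -
    \<comment> \<open>Translation by \<open>m\<close> maps \<open>closure M\<close> into itself, so
      \<open>m + p\<close> competes with the nearest point \<open>p\<close>, and the obtuse angle
      criterion applies to it.\<close>
    have "(+) m ` M \<subseteq> M"
      using assms that by (auto intro: subspace_add)
    then have "(+) m ` closure M \<subseteq> closure M"
      unfolding closure_translation [symmetric] by (rule closure_mono)
    with p(1) have "m + p \<in> closure M"
      by blast
    from any_closest_point_dot[OF conv closed_closure p(1) this p(2)] show ?thesis
      by simp
  qed
  \<comment> \<open>The inequality for both \<open>m\<close> and \<open>- m\<close> forces
    equality.\<close>
  have "inner (x - p) m = 0" if "m \<in> M" for m
    using le[OF that] le[of "- m"] assms that by (simp add: subspace_neg)
  with p(1) show ?thesis
    by blast
qed

section \<open>Complex inner products and orthogonal complements\<close>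

lemma cinner_add_right: "cinner x (y + z) = cinner x y + cinner x z"
  by (metis cinner_add_left cinner_commute complex_cnj_add)

lemma cinner_scaleC_right: "cinner x (a *\<^sub>C y) = cnj a * cinner x y"
  by (metis cinner_commute cinner_scaleC_left complex_cnj_mult)

lemma cinner_zero_left [simp]: "cinner 0 y = 0"
  using cinner_add_left[of 0 0 y] by simp

lemma cinner_diff_left: "cinner (x - y) z = cinner x z - cinner y z"
  using cinner_add_left[of "x - y" y z] by simp

lemma cinner_minus_left: "cinner (- x) z = - cinner x z"
  using cinner_diff_left[of 0 x z] by simp

lemma cinner_eq_zero_commute: "cinner x y = 0 \<longleftrightarrow> cinner y x = 0"
  by (metis cinner_commute complex_cnj_zero_iff)

text \<open>Recovers the complex form from the real one, so that continuity and orthogonality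
  transfer from real inner product spaces.\<close>

lemma cinner_conv_inner: "cinner x y = Complex (inner x y) (inner x (\<i> *\<^sub>C y))"
  by (rule complex_eqI) (simp_all add: cinner_scaleC_right flip: Re_cinner)

lemma continuous_on_cinner_left: "continuous_on A (\<lambda>x. cinner x y)"
  unfolding cinner_conv_inner by (intro continuous_intros)

lemma continuous_on_cinner_right: "continuous_on A (cinner x)"
proof -
  have "continuous_on A (\<lambda>y. cnj (cinner y x))"
    by (intro continuous_intros continuous_on_cinner_left)
  then show ?thesis
    by (simp flip: cinner_commute)
qed

lemma csubspace_imp_subspace: "csubspace M \<Longrightarrow> subspace M"
  unfolding complex_vector.subspace_def subspace_def
  by (simp flip: scaleC_of_real)

lemma zero_in_cortho_comp [simp]: "0 \<in> cortho_comp M"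
  by (simp add: cortho_comp_def)

lemma uminus_in_cortho_comp [simp]: "- x \<in> cortho_comp M \<longleftrightarrow> x \<in> cortho_comp M"
  by (simp add: cortho_comp_def cinner_minus_left)

lemma closed_cortho_comp [simp]: "closed (cortho_comp M)"
proof -
  have "cortho_comp M = (\<Inter>m\<in>M. {x. cinner x m = 0})"
    by (auto simp: cortho_comp_def)
  then show ?thesis
    by (auto intro!: closed_Collect_eq continuous_on_cinner_left continuous_on_const)
qed

lemma cortho_comp_closure [simp]: "cortho_comp (closure M) = cortho_comp M"
proof
  show "cortho_comp (closure M) \<subseteq> cortho_comp M"
    using closure_subset unfolding cortho_comp_def by blast
  have "closure M \<subseteq> {m. cinner x m = 0}" if "x \<in> cortho_comp M" for x
    using that
    by (intro closure_minimal closed_Collect_eq continuous_on_cinner_right continuous_on_const)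
      (auto simp: cortho_comp_def)
  then show "cortho_comp M \<subseteq> cortho_comp (closure M)"
    by (auto simp: cortho_comp_def)
qed

lemma cortho_comp_cortho_comp:
  fixes M :: "'a::chilbert_space set"
  assumes "csubspace M"
  shows "cortho_comp (cortho_comp M) = closure M"
proof
  have "M \<subseteq> cortho_comp (cortho_comp M)"
    by (auto simp: cortho_comp_def cinner_eq_zero_commute)
  then show "closure M \<subseteq> cortho_comp (cortho_comp M)"
    by (rule closure_minimal) simp
  show "cortho_comp (cortho_comp M) \<subseteq> closure M"
  proof
    fix z
    assume z: "z \<in> cortho_comp (cortho_comp M)"
    obtain p where p: "p \<in> closure M" "\<forall>m\<in>M. inner (z - p) m = 0"
      using subspace_orthogonal_projection_exists[OF csubspace_imp_subspace[OF assms]] by blast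
    \<comment> \<open>The projection gives only real orthogonality. As \<open>M\<close> is stable
      under \<open>\<i>\<close>, the imaginary part of the complex inner product vanishes
      too.\<close>
    have "\<i> *\<^sub>C m \<in> M" if "m \<in> M" for m
      using assms that by (simp add: complex_vector.subspace_def)
    then have *: "z - p \<in> cortho_comp M"
      using p(2) by (auto simp: cortho_comp_def cinner_conv_inner complex_eq_iff)
    \<comment> \<open>Both \<open>z\<close> and \<open>p\<close> are orthogonal to
      \<open>z - p\<close>, so \<open>z - p\<close> is orthogonal to itself and
      \<open>z = p\<close>.\<close>
    then have "cinner z (z - p) = 0"
      using z by (simp add: cortho_comp_def)
    moreover have "cinner p (z - p) = 0"
      using * p(1) by (subst (asm) cortho_comp_closure [symmetric])
        (simp add: cortho_comp_def cinner_eq_zero_commute)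
    ultimately have "inner (z - p) (z - p) = 0"
      by (simp add: cinner_diff_left flip: Re_cinner)
    with p(1) show "z \<in> closure M"
      by simp
  qed
qed

section \<open>Closure and adjoint of multivalued projections\<close>

lemma mproj_iff:
  fixes M N :: "'a::ab_group_add set"
  shows "(x, y) \<in> mproj M N \<longleftrightarrow> y \<in> M \<and> x - y \<in> N"
proof
  assume "y \<in> M \<and> x - y \<in> N"
  moreover have "x = y + (x - y)"
    by simp
  ultimately show "(x, y) \<in> mproj M N"
    unfolding mproj_def by blast
qed (auto simp: mproj_def)

lemma Domain_mproj: "Domain (mproj M N) = M + N"
  by (auto simp: mproj_def set_plus_def)

lemma closure_mproj:
  fixes M N :: "'a::real_normed_vector set"
  shows "closure (mproj M N) = mproj (closure M) (closure N)"
proof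
  \<comment> \<open>The inverse coordinates \<open>snd z\<close> and \<open>fst z - snd z\<close>
    are continuous, so this is an intersection of closed preimages.\<close>
  have "mproj (closure M) (closure N) = snd -` closure M \<inter> (\<lambda>z. fst z - snd z) -` closure N"
    by (auto simp: mproj_iff)
  moreover have "closed (snd -` closure M \<inter> (\<lambda>z::'a \<times> 'a. fst z - snd z) -` closure N)"
    by (intro closed_Int closed_vimage closed_closure continuous_intros)
  moreover have "mproj M N \<subseteq> mproj (closure M) (closure N)"
    using closure_subset by (fastforce simp: mproj_def)
  ultimately show "closure (mproj M N) \<subseteq> mproj (closure M) (closure N)"
    by (metis closure_minimal)
  \<comment> \<open>For the other inclusion the forward map is used: a continuous map sends the
    closure of \<open>M \<times> N\<close> into the closure of its image.\<close>
  have eq: "mproj A B = (\<lambda>(m, n). (m + n, m)) ` (A \<times> B)" for A B :: "'a set"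
    by (auto simp: mproj_def)
  show "mproj (closure M) (closure N) \<subseteq> closure (mproj M N)"
    unfolding eq closure_Times [symmetric] case_prod_unfold
    by (intro continuous_image_closure_subset[of UNIV] continuous_intros) auto
qed

text \<open>Since both sets contain 0, the condition on sums \<open>m + n\<close> splits:
  \<open>m = 0\<close> yields that \<open>y\<close> is orthogonal to \<open>N\<close>, and
  \<open>n = 0\<close> that \<open>x - y\<close> is orthogonal to \<open>M\<close>.\<close>

lemma rel_adjoint_mproj:
  fixes M N :: "'a::complex_inner set"
  assumes "0 \<in> M" "0 \<in> N"
  shows "rel_adjoint (mproj M N) = mproj (cortho_comp N) (cortho_comp M)"
proof -
  have "(\<forall>m\<in>M. \<forall>n\<in>N. cinner m x = cinner (m + n) y)
      \<longleftrightarrow> (\<forall>n\<in>N. cinner n y = 0) \<and> (\<forall>m\<in>M. cinner m x = cinner m y)" for x y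
    using assms by (force simp: cinner_add_left)
  moreover have "(\<forall>m\<in>M. cinner m x = cinner m y) \<longleftrightarrow> x - y \<in> cortho_comp M" for x y
    unfolding cortho_comp_def
    by (simp add: cinner_diff_left) (metis cinner_commute)
  moreover have "(\<forall>n\<in>N. cinner n y = 0) \<longleftrightarrow> y \<in> cortho_comp N" for y
    by (simp add: cortho_comp_def cinner_eq_zero_commute)
  moreover have "(x, y) \<in> rel_adjoint (mproj M N)
      \<longleftrightarrow> (\<forall>m\<in>M. \<forall>n\<in>N. cinner m x = cinner (m + n) y)" for x y
    by (auto simp: rel_adjoint_def mproj_def)
  ultimately show ?thesis
    by (auto simp: mproj_iff)
qed

section \<open>Selfadjoint \<open>W\<close> and its companion subspaces\<close>

lemma bounded_selfadjoint_cinner: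
  assumes "bounded_selfadjoint W"
  shows "cinner (W x) y = cinner x (W y)"
proof -
  have "(y, W y) \<in> rel_adjoint (graph_of W)"
    using assms by (simp add: bounded_selfadjoint_def graph_of_def)
  then show ?thesis
    by (auto simp: rel_adjoint_def graph_of_def)
qed

lemma W_companion_eq_cortho_comp:
  assumes "bounded_selfadjoint W"
  shows "W_companion W S = cortho_comp (W ` S)"
  by (simp add: W_companion_def cortho_comp_def bounded_selfadjoint_cinner[OF assms])

text \<open>With \<open>S\<close> itself under the complement, \<open>cortho_comp_closure\<close>
  shows that passing to \<open>closure S\<close> leaves the companion unchanged.\<close>

lemma W_companion_eq_vimage: "W_companion W S = W -` cortho_comp S"
  by (auto simp: W_companion_def cortho_comp_def)

lemma csubspace_bounded_selfadjoint_image: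
  assumes "bounded_selfadjoint W" "csubspace S"
  shows "csubspace (W ` S)"
proof -
  interpret Vector_Spaces.linear scaleC scaleC W
    using assms(1) by (simp add: bounded_selfadjoint_def bounded_clinear_def)
  show ?thesis
    using assms(2) unfolding csubspace_def by (rule subspace_image)
qed

lemma positive_semidefinite_form_zero_imp_kernel:
  assumes W: "bounded_selfadjoint W" "positive_semidefinite W"
    and x: "cinner (W x) x = 0"
  shows "W x = 0"
proof -
  interpret Vector_Spaces.linear scaleC scaleC W
    using W(1) by (simp add: bounded_selfadjoint_def bounded_clinear_def)
  define c where "c = inner (W x) (W x)"
  define b where "b = inner (W (W x)) (W x)"
  \<comment> \<open>This is the form at \<open>x + t *\<^sub>R W x\<close>; its constant term
    vanishes by assumption, so the linear coefficient, twice the squared norm of \<open>W x\<close>,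
    has to vanish as well.\<close>
  have nonneg: "0 \<le> 2 * t * c + t\<^sup>2 * b" for t :: real
  proof -
    define y where "y = x + t *\<^sub>R W x"
    have "W y = W x + t *\<^sub>R W (W x)"
      unfolding y_def by (metis add scale scaleC_of_real)
    moreover have "inner (W x) x = 0"
      using x by (simp flip: Re_cinner)
    moreover have "inner (W (W x)) x = c"
      by (simp add: c_def bounded_selfadjoint_cinner[OF W(1)] flip: Re_cinner)
    moreover have "0 \<le> inner (W y) y"
      using W(2) unfolding positive_semidefinite_def
      by (metis Re_cinner complex_nonneg_Reals_iff)
    ultimately show ?thesis
      by (simp add: y_def inner_simps c_def b_def power2_eq_square algebra_simps)
  qed
  have "c = 0"
  proof (rule ccontr)
    assume "c \<noteq> 0"
    then have "c > 0"
      by (simp add: c_def)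
    have "b \<ge> 0"
      using W(2) unfolding positive_semidefinite_def b_def
      by (metis Re_cinner complex_nonneg_Reals_iff)
    \<comment> \<open>The minimizer of the quadratic would be \<open>- c / b\<close>; the shifted
      denominator also covers \<open>b = 0\<close>.\<close>
    have "0 \<le> 2 * (- c / (b + 1)) * c + (- c / (b + 1))\<^sup>2 * b"
      by (rule nonneg)
    also have "\<dots> = - (c\<^sup>2 * (b + 2)) / (b + 1)\<^sup>2"
    proof -
      have "b + 1 \<noteq> 0"
        using \<open>b \<ge> 0\<close> by simp
      then show ?thesis
        by (simp add: divide_simps) (simp add: algebra_simps power2_eq_square)
    qed
    also have "\<dots> < 0"
      using \<open>b \<ge> 0\<close> \<open>c > 0\<close> by (simp add: divide_neg_pos)
    finally show False
      by simp
  qed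
  then show ?thesis
    by (simp add: c_def)
qed

section \<open>Multivalued part, adjoint, closure and symmetry of \<open>W_proj\<close>\<close>

lemma mul_W_proj:
  assumes "bounded_selfadjoint W"
  shows "mul (W_proj W S) = S \<inter> cortho_comp (W ` S)"
  by (auto simp: mul_def W_proj_def mproj_iff W_companion_eq_cortho_comp[OF assms])

lemma mul_W_proj_positive_semidefinite:
  assumes "bounded_selfadjoint W" "positive_semidefinite W"
  shows "mul (W_proj W S) = S \<inter> {x. W x = 0}"
proof -
  have "mul (W_proj W S) = S \<inter> W_companion W S"
    by (simp add: mul_W_proj W_companion_eq_cortho_comp assms)
  \<comment> \<open>A vector of \<open>S\<close> in the companion may be tested against itself,
    which makes the form vanish there.\<close>
  also have "\<dots> = S \<inter> {x. W x = 0}"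
    by (auto simp: W_companion_def positive_semidefinite_form_zero_imp_kernel[OF assms])
  finally show ?thesis .
qed

lemma rel_adjoint_W_proj:
  fixes W :: "'a::chilbert_space \<Rightarrow> 'a"
  assumes "bounded_selfadjoint W" "csubspace S"
  shows "rel_adjoint (W_proj W S) = mproj (closure (W ` S)) (cortho_comp S)"
proof -
  have "0 \<in> S"
    using assms(2) by (simp add: complex_vector.subspace_def)
  then show ?thesis
    by (simp add: W_proj_def W_companion_eq_cortho_comp assms rel_adjoint_mproj
        cortho_comp_cortho_comp csubspace_bounded_selfadjoint_image)
qed

lemma closure_W_proj:
  assumes "bounded_selfadjoint W"
  shows "closure (W_proj W S) = W_proj W (closure S)"
proof -
  have "closed (W_companion W S)"
    by (simp add: W_companion_eq_cortho_comp assms)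
  moreover have "W_companion W (closure S) = W_companion W S"
    by (simp add: W_companion_eq_vimage)
  ultimately show ?thesis
    by (simp add: W_proj_def closure_mproj)
qed

text \<open>The range recovers \<open>S\<close> from the relation, so equal relations come from
  equal subspaces; this gives the step from a closed relation to a closed \<open>S\<close>.\<close>

lemma Range_W_proj:
  assumes "bounded_selfadjoint W"
  shows "Range (W_proj W S) = S"
proof -
  have "(y, y) \<in> W_proj W S" if "y \<in> S" for y
    using that by (simp add: W_proj_def mproj_iff W_companion_eq_cortho_comp assms)
  moreover have "Range (W_proj W S) \<subseteq> S"
    by (auto simp: W_proj_def mproj_iff)
  ultimately show ?thesis
    by blast
qed

lemma closed_W_proj_iff:
  assumes "bounded_selfadjoint W"
  shows "closed (W_proj W S) \<longleftrightarrow> closed S"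
proof
  assume "closed (W_proj W S)"
  then have "W_proj W (closure S) = W_proj W S"
    by (simp flip: closure_W_proj[OF assms])
  then have "Range (W_proj W (closure S)) = Range (W_proj W S)"
    by (rule arg_cong)
  then have "closure S = S"
    by (simp add: Range_W_proj assms)
  then show "closed S"
    by (metis closed_closure)
next
  assume "closed S"
  then have "closure (W_proj W S) = W_proj W S"
    by (simp add: closure_W_proj[OF assms])
  then show "closed (W_proj W S)"
    by (metis closed_closure)
qed

lemma W_symmetric_W_proj:
  assumes "bounded_selfadjoint W"
  shows "W_symmetric W (W_proj W S)"
proof -
  note sa = bounded_selfadjoint_cinner[OF assms]
  have orth: "cinner n (W m) = 0" "cinner (W m) n = 0"
    if "m \<in> S" "n \<in> W_companion W S" for m n
    using that by (simp_all add: W_companion_def sa cinner_eq_zero_commute[of m])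
  \<comment> \<open>The cross terms with \<open>n\<close> and \<open>n'\<close> vanish by
    \<open>orth\<close>; what remains is the symmetry of \<open>W\<close> on \<open>m\<close> and
    \<open>m'\<close>.\<close>
  have "cinner (W m) (m' + n') = cinner (m + n) (W m')"
    if "m \<in> S" "m' \<in> S" "n \<in> W_companion W S" "n' \<in> W_companion W S" for m m' n n'
    unfolding cinner_add_left cinner_add_right using that by (simp add: orth) (rule sa)
  moreover have "W_proj W S O graph_of W = {(m + n, W m) | m n. m \<in> S \<and> n \<in> W_companion W S}"
    by (auto simp: W_proj_def mproj_def graph_of_def)
  ultimately show ?thesis
    by (auto simp: W_symmetric_def rel_adjoint_def)
qed

theorem lemma4p1:
  fixes W :: "'a::chilbert_space \<Rightarrow> 'a"
    and S :: "'a set"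
  assumes "separable_space (euclidean :: 'a topology)"
    and "bounded_selfadjoint W"
    and "csubspace S"
  shows
    "(Domain (W_proj W S) = S + cortho_comp (W ` S)
      \<and> mul (W_proj W S) = S \<inter> cortho_comp (W ` S)
      \<and> (positive_semidefinite W \<longrightarrow> mul (W_proj W S) = S \<inter> {x. W x = 0}))
     \<and> (rel_adjoint (W_proj W S) = mproj (closure (W ` S)) (cortho_comp S)
      \<and> closure (W_proj W S) = W_proj W (closure S)
      \<and> (closed (W_proj W S) \<longleftrightarrow> closed S))
     \<and> W_symmetric W (W_proj W S)"
proof (intro conjI impI)
  show "Domain (W_proj W S) = S + cortho_comp (W ` S)"
    by (simp add: W_proj_def W_companion_eq_cortho_comp assms Domain_mproj)
  show "mul (W_proj W S) = S \<inter> {x. W x = 0}" if "positive_semidefinite W"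
    using assms(2) that by (rule mul_W_proj_positive_semidefinite)
qed (simp_all only: mul_W_proj rel_adjoint_W_proj closure_W_proj closed_W_proj_iff
  W_symmetric_W_proj assms)

end
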